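(* There are absolute constants $C_1, C_2 > 0$ such that the following holds. Let $n \geq 4$ be an integer, let $T_n$ be the Symmetric Traveling Salesman Polytope on $n$ cities, and let $k$ be a positive integer with $k \leq n^{1/3}$. Then there exist a polytope $P_k^\circ$ (in some finite-dimensional real vector space) with at most $C_1 n^{4k}$ facets, a linear transformation $T$ from that space to $\mathbb{R}^{n^2}$, and a constant $c_k$ with $$\left| c_k - \frac{k}{n} \right| \leq \frac{C_2}{n}$$ (that is, $P_k^\circ$ has $O(n^{4k})$ facets and $c_k = \frac kn + O\left(\frac1n\right)$) such that, for $Q_k = T(P_k^\circ)$, $$c_k (Q_k - Z) \subset T_n - Z \subset Q_k - Z.$$
   Context: Let $K_n$ be the complete graph on $\{1,\dots,n\}$. To each Hamiltonian cycle in $K_n$ (a cycle visiting every vertex exactly once) associate its incidence matrix $(a_{ij}) \in \mathbb{R}^{n^2}$, where $a_{ij}=1$ if the cycle contains the edge $\{i,j\}$ and $a_{ij}=0$ otherwise. The Symmetric Traveling Salesman Polytope $T_n \subset \mathbb{R}^{n^2}$ is the convex hull of all these matrices. $Z = (z_{ij})$ is its barycenter: $z_{ij} = \frac{2}{n-1}$ if $i \neq j$ and $z_{ii} = 0$. For a set $S$, a vector $v$ and a scalar $c$, $S - v = \{s - v : s \in S\}$ and $cS = \{cs : s\in S\}$. *)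

theory Defs
  imports "HOL-Analysis.Analysis" "HOL-Library.Function_Algebras"
begin

text \<open>
  The dimensions of the spaces involved depend on the integers n and k, which are bound
  inside the statement, so they cannot be types. A vector in a space of dimension d is a
  function of type \<^typ>\<open>nat \<Rightarrow> real\<close> that vanishes outside d fixed coordinates, and similarly
  for matrices. With the pointwise vector space structure on functions, the library notions
  \<^term>\<open>convex hull S\<close>, \<^const>\<open>polytope\<close>, \<^term>\<open>F face_of S\<close> and \<^const>\<open>linear\<close> apply directly.
\<close>

instantiation "fun" :: (type, real_vector) real_vector
begin

definition scaleR_fun :: "real \<Rightarrow> ('a \<Rightarrow> 'b) \<Rightarrow> 'a \<Rightarrow> 'b"
  where "scaleR_fun c f = (\<lambda>x. c *\<^sub>R f x)"

instance
  by standard (simp_all add: scaleR_fun_def fun_eq_iff scaleR_add_right scaleR_add_left)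

end

definition vec_space :: "nat \<Rightarrow> (nat \<Rightarrow> real) set"
  where "vec_space d = {x. \<forall>i. d \<le> i \<longrightarrow> x i = 0}"

definition matrix_space :: "nat \<Rightarrow> (nat \<Rightarrow> nat \<Rightarrow> real) set"
  where "matrix_space n = {A. \<forall>i j. i \<notin> {1..n} \<or> j \<notin> {1..n} \<longrightarrow> A i j = 0}"


text \<open>
  The library's \<^const>\<open>aff_dim\<close> and \<^const>\<open>facet_of\<close> are restricted to the class
  \<^class>\<open>euclidean_space\<close>; these are the same definitions over any real vector space.
  Finiteness of B has to be demanded, since infinite sets have cardinality 0. The value of
  \<open>affine_dim V\<close> is meaningful only if the affine hull of V is finite-dimensional.
\<close>

definition affine_dim :: "'a::real_vector set \<Rightarrow> int"
  where "affine_dim V =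
    (SOME d. \<exists>B. finite B \<and> affine hull B = affine hull V \<and> \<not> affine_dependent B \<and>
       of_nat (card B) = d + 1)"

definition is_facet :: "'a::real_vector set \<Rightarrow> 'a set \<Rightarrow> bool"
  where "is_facet F S \<longleftrightarrow> F face_of S \<and> F \<noteq> {} \<and> affine_dim F = affine_dim S - 1"

lemma affine_dim_eq_aff_dim: "affine_dim V = aff_dim V"
  for V :: "'a::euclidean_space set"
  using aff_independent_finite unfolding affine_dim_def aff_dim_def by metis

lemma is_facet_iff_facet_of: "is_facet F S \<longleftrightarrow> F facet_of S"
  for S :: "'a::euclidean_space set"
  by (simp add: is_facet_def facet_of_def affine_dim_eq_aff_dim)


definition complete_graph :: "nat \<Rightarrow> nat set set"
  where "complete_graph n = {{i, j} |i j. i \<in> {1..n} \<and> j \<in> {1..n} \<and> i \<noteq> j}"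

definition cycle_edges :: "'a list \<Rightarrow> 'a set set"
  where "cycle_edges vs = {{vs ! i, vs ! (Suc i mod length vs)} |i. i < length vs}"

text \<open>A cycle is identified with its set of edges, a graph with its set of edges.\<close>

definition hamiltonian_cycles :: "'a set \<Rightarrow> 'a set set \<Rightarrow> 'a set set set"
  where "hamiltonian_cycles V G =
    {cycle_edges vs |vs. distinct vs \<and> set vs = V \<and> 3 \<le> length vs \<and> cycle_edges vs \<subseteq> G}"

definition incidence_matrix :: "nat set set \<Rightarrow> nat \<Rightarrow> nat \<Rightarrow> real"
  where "incidence_matrix E = (\<lambda>i j. if {i, j} \<in> E then 1 else 0)"

definition tsp_polytope :: "nat \<Rightarrow> (nat \<Rightarrow> nat \<Rightarrow> real) set"
  where "tsp_polytope n =
    convex hull (incidence_matrix ` hamiltonian_cycles {1..n} (complete_graph n))"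

definition barycenter :: "nat \<Rightarrow> nat \<Rightarrow> nat \<Rightarrow> real"
  where "barycenter n =
    (\<lambda>i j. if i \<in> {1..n} \<and> j \<in> {1..n} \<and> i \<noteq> j then 2 / (real n - 1) else 0)"

definition set_minus_vec :: "'a::real_vector set \<Rightarrow> 'a \<Rightarrow> 'a set"
  where "set_minus_vec S v = {s - v |s. s \<in> S}"

definition set_scale :: "real \<Rightarrow> 'a::real_vector set \<Rightarrow> 'a set"
  where "set_scale c S = {c *\<^sub>R s |s. s \<in> S}"

end

theory Submission
  imports Defs
begin

text \<open>
  A projection of a simplex with few vertices is the convex hull of few points, and a simplex has
  as many facets as vertices. So everything reduces to finding at most \<open>n\<^sup>2\<^sup>k\<close> points of
  the polytope whose convex hull contains the contracted copy \<open>Z + c (T\<^sub>n - Z)\<close>; expanding these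
  points from \<open>Z\<close> by the factor \<open>1/c\<close> gives the vertices of \<open>Q\<^sub>k\<close>.

  For an edge \<open>e\<close> let \<open>D(e)\<close> be the average of all Hamiltonian cycles through \<open>e\<close>, minus \<open>Z\<close>
  (\<open>edge_deviation\<close>). Two facts make these matrices useful. They are additive along cycles:
  \<open>X - Z\<close> is the sum of \<open>D(e)\<close> over the edges \<open>e\<close> of the Hamiltonian cycle with incidence matrix
  \<open>X\<close> (\<open>sum_edge_deviation_cycle\<close>). And they can be realised simultaneously, almost at full
  strength: if \<open>M\<close> consists of \<open>k\<close> edges of a Hamiltonian cycle with no further edge of the cycle
  joining two of their endpoints, then \<open>Z + \<alpha> \<Sum>\<^bsub>e\<in>M\<^esub> D(e)\<close> lies in the polytope for some \<open>\<alpha>\<close>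
  close to 1 that depends on \<open>n\<close> and \<open>k\<close> only (\<open>matching_point_in_tsp_polytope\<close>). These points
  are the ones sought: each is given by the list of the \<open>2k\<close> endpoints of \<open>M\<close>, and the mean of
  the points for the \<open>n\<close> rotations of one matching around the cycle is \<open>Z + (\<alpha>k/n) (X - Z)\<close>.

  For the second fact, let \<open>S\<close> be the set of endpoints of \<open>M\<close> and average the cycle over all
  permutations of the vertices outside \<open>S\<close>. The result \<open>R\<close> lies in the polytope, and since all
  row sums are 2, symmetry determines its entries. It falls short of \<open>Z + \<Sum>\<^bsub>e\<in>M\<^esub> D(e)\<close> by exactly
  \<open>\<mu> \<Sum> D(e)\<close>, summed over all pairs \<open>e\<close> in \<open>S\<close>, where \<open>\<mu>\<close> (\<open>overlap\<close>) is of order \<open>k/n\<^sup>2\<close>.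
  The sign is what matters: the missing terms for the pairs outside \<open>M\<close> can be put back by adding
  the points \<open>Z + D(e)\<close> of the polytope with weight \<open>\<mu>\<close>, at a cost of total weight about
  \<open>2k\<^sup>2\<mu>\<close>. Hence \<open>\<alpha> = 1 - O(k\<^sup>3/n\<^sup>2)\<close>, and \<open>\<alpha>k/n\<close> differs from \<open>k/n\<close> by \<open>O(1/n)\<close>
  as long as \<open>k\<^sup>3 \<le> n\<close>.
\<close>

section \<open>Simplices and their facets\<close>

text \<open>
  If a point of \<open>F\<close> gives positive weight to a vertex \<open>b\<close>, then it is \<open>b\<close> or lies strictly between
  \<open>b\<close> and the weighted mean of the other vertices, so the face also contains \<open>b\<close>. Thus the points of \<open>F\<close>
  only use vertices in \<open>F\<close>.
\<close>

lemma face_of_convex_hull_finite: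
  fixes B :: "'a::real_vector set"
  assumes "finite B" and "F face_of convex hull B"
  shows "F = convex hull (F \<inter> B)"
proof
  have conv: "convex F" and sub: "F \<subseteq> convex hull B"
    and seg: "\<And>a b x. a \<in> convex hull B \<Longrightarrow> b \<in> convex hull B \<Longrightarrow> x \<in> F \<Longrightarrow>
      x \<in> open_segment a b \<Longrightarrow> a \<in> F"
    using assms(2) unfolding face_of_def by blast+
  show "convex hull (F \<inter> B) \<subseteq> F"
    using conv by (intro hull_minimal) auto
  show "F \<subseteq> convex hull (F \<inter> B)"
  proof
    fix x assume x: "x \<in> F"
    then obtain u where u: "\<And>b. b \<in> B \<Longrightarrow> 0 \<le> u b" "sum u B = 1" "(\<Sum>b\<in>B. u b *\<^sub>R b) = x"
      using sub convex_hull_finite[OF assms(1)] by auto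
    have inF: "b \<in> F" if b: "b \<in> B" "u b \<noteq> 0" for b
    proof (cases "x = b")
      case True then show ?thesis using x by simp
    next
      case False
      have ub: "0 < u b" using u(1) b by (simp add: order_less_le)
      have sum1: "sum u (B - {b}) = 1 - u b"
        using u(2) assms(1) b(1) by (simp add: sum_diff1)
      have sumv: "(\<Sum>c\<in>B-{b}. u c *\<^sub>R c) = x - u b *\<^sub>R b"
        using u(3) assms(1) b(1) by (simp add: sum_diff1)
      have "u b \<noteq> 1"
      proof
        assume one: "u b = 1"
        then have "\<forall>c\<in>B-{b}. u c = 0"
          using sum1 u(1) assms(1) sum_nonneg_eq_0_iff[of "B - {b}" u] by simp
        then have "(\<Sum>c\<in>B-{b}. u c *\<^sub>R c) = 0" by simp
        then show False using sumv one False by simp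
      qed
      moreover have "0 \<le> sum u (B - {b})" using u(1) by (intro sum_nonneg) auto
      ultimately have lt: "u b < 1" using sum1 by simp
      define y where "y = (\<Sum>c\<in>B-{b}. (u c / (1 - u b)) *\<^sub>R c)"
      have y_eq: "(1 - u b) *\<^sub>R y = x - u b *\<^sub>R b"
        unfolding y_def scaleR_sum_right sumv[symmetric] using lt by simp
      have "y \<in> convex hull B" unfolding y_def
      proof (rule convex_sum)
        show "(\<Sum>c\<in>B-{b}. u c / (1 - u b)) = 1"
          using lt sum1 by (simp flip: sum_divide_distrib)
      qed (use assms(1) u(1) lt in \<open>auto intro: hull_inc\<close>)
      moreover have "x = (1 - (1 - u b)) *\<^sub>R b + (1 - u b) *\<^sub>R y"
        using y_eq by simp
      moreover have "b \<noteq> y"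
      proof
        assume "b = y"
        then have "(1 - u b) *\<^sub>R b = x - u b *\<^sub>R b" using y_eq by simp
        then show False using False by (simp add: algebra_simps)
      qed
      ultimately have "x \<in> open_segment b y" "y \<in> convex hull B"
        using ub lt unfolding in_segment by (auto intro!: exI[of _ "1 - u b"])
      then show "b \<in> F" using seg[OF _ _ x, of b y] b(1) by (simp add: hull_inc)
    qed
    have "x = (\<Sum>b\<in>F\<inter>B. u b *\<^sub>R b)"
      unfolding u(3)[symmetric] by (rule sum.mono_neutral_right) (use assms(1) inF in auto)
    also have "\<dots> \<in> convex hull (F \<inter> B)"
    proof (rule convex_sum)
      show "sum u (F \<inter> B) = 1"
        unfolding u(2)[symmetric] by (rule sum.mono_neutral_left) (use assms(1) inF in auto)
    qed (use assms(1) u(1) in \<open>auto intro: hull_inc\<close>)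
    finally show "x \<in> convex hull (F \<inter> B)" .
  qed
qed

text \<open>
  The exchange bound for linear spans, applied to the differences with a base point. It makes the
  number of points in an affine basis unique, which is what gives \<^const>\<open>affine_dim\<close> its meaning.
\<close>

lemma card_le_if_affine_independent:
  fixes B C :: "'a::real_vector set"
  assumes "finite B" "finite C" "\<not> affine_dependent B" "B \<subseteq> affine hull C"
  shows "card B \<le> card C"
proof (cases "B = {}")
  case False
  then obtain b where b: "b \<in> B" by blast
  have "C \<noteq> {}" using assms(4) b by auto
  then obtain c where c: "c \<in> C" by blast
  let ?D = "(\<lambda>x. -c + x) ` (C - {c})"
  have in_span: "x - c \<in> span ?D" if "x \<in> B" for x
    using assms(4) that affine_hull_span2[OF c] by auto
  have "(\<lambda>x. -b + x) ` (B - {b}) \<subseteq> span ?D"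
  proof (intro image_subsetI)
    fix x assume "x \<in> B - {b}"
    then show "-b + x \<in> span ?D"
      using span_diff[OF in_span[of x] in_span[OF b]] by simp
  qed
  then have "card ((\<lambda>x. -b + x) ` (B - {b})) \<le> card ?D"
    using assms(2,3) affine_dependent_iff_dependent2[OF b]
    by (intro conjunct2[OF independent_span_bound]) auto
  then have "card (B - {b}) \<le> card (C - {c})"
    by (simp add: card_image)
  moreover have "0 < card C" using assms(2) c by (auto simp: card_gt_0_iff)
  ultimately show ?thesis
    using b c by simp
qed simp

lemma affine_dim_simplex:
  fixes B :: "'a::real_vector set"
  assumes "finite B" "\<not> affine_dependent B"
  shows "affine_dim (convex hull B) = int (card B) - 1"
  unfolding affine_dim_def
proof (rule some_equality)
  show "\<exists>B'. finite B' \<and> affine hull B' = affine hull (convex hull B) \<and> \<not> affine_dependent B' \<and>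
      int (card B') = (int (card B) - 1) + 1"
    using assms by (intro exI[of _ B]) simp
next
  fix d assume "\<exists>B'. finite B' \<and> affine hull B' = affine hull (convex hull B) \<and>
    \<not> affine_dependent B' \<and> int (card B') = d + 1"
  then obtain B' where B': "finite B'" "affine hull B' = affine hull B" "\<not> affine_dependent B'"
    "int (card B') = d + 1" by auto
  have "card B' = card B"
    using card_le_if_affine_independent[OF B'(1) assms(1) B'(3)]
      card_le_if_affine_independent[OF assms(1) B'(1) assms(2)] B'(2)
    by (metis hull_subset order_antisym)
  then show "d = int (card B) - 1" using B'(4) by simp
qed

text \<open>
  A face is spanned by the vertices that it contains; dropping the dimension by one means
  dropping exactly one vertex.
\<close>

lemma facets_of_simplex:
  fixes B :: "'a::real_vector set"
  assumes "finite B" "\<not> affine_dependent B"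
  shows "{F. is_facet F (convex hull B)} \<subseteq> (\<lambda>b. convex hull (B - {b})) ` B"
proof clarify
  fix F assume "is_facet F (convex hull B)"
  then have F: "F face_of convex hull B" "affine_dim F = affine_dim (convex hull B) - 1"
    unfolding is_facet_def by auto
  have eq: "F = convex hull (F \<inter> B)" by (rule face_of_convex_hull_finite[OF assms(1) F(1)])
  have ind: "\<not> affine_dependent (F \<inter> B)"
    using assms(2) affine_dependent_subset by blast
  have "int (card (F \<inter> B)) = int (card B) - 1"
    using F(2) affine_dim_simplex[OF assms] affine_dim_simplex[OF _ ind] assms(1) eq by simp
  then have "card (B - F \<inter> B) = 1"
    using assms(1) by (subst card_Diff_subset) auto
  then obtain b where "B - F \<inter> B = {b}" using card_1_singletonE by blast
  then have "F \<inter> B = B - {b}" "b \<in> B" by blast+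
  then show "F \<in> (\<lambda>b. convex hull (B - {b})) ` B" using eq by auto
qed

lemma scaleR_fun_apply [simp]: "(c *\<^sub>R f) x = c *\<^sub>R f x"
  for f :: "'a \<Rightarrow> 'b::real_vector"
  by (simp add: scaleR_fun_def)

lemma sum_fun_apply: "(\<Sum>i\<in>I. f i) x = (\<Sum>i\<in>I. f i x)"
  for f :: "'c \<Rightarrow> 'a \<Rightarrow> 'b::comm_monoid_add"
  by (induction I rule: infinite_finite_induct) auto

definition std_basis :: "nat \<Rightarrow> (nat \<Rightarrow> real) set"
  where "std_basis d = (\<lambda>i j. of_bool (i = j)) ` {..<d}"

lemma affine_independent_std_basis: "\<not> affine_dependent (std_basis d)"
proof
  assume "affine_dependent (std_basis d)"
  then obtain i where i: "(\<lambda>j. of_bool (i = j)) \<in> affine hull (std_basis d - {\<lambda>j. of_bool (i = j)})"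
    unfolding affine_dependent_def std_basis_def by auto
  have "affine {x :: nat \<Rightarrow> real. x i = 0}" by (simp add: affine_def)
  moreover have "std_basis d - {\<lambda>j. of_bool (i = j)} \<subseteq> {x. x i = 0}"
    by (auto simp: std_basis_def)
  ultimately have "affine hull (std_basis d - {\<lambda>j. of_bool (i = j)}) \<subseteq> {x. x i = 0}"
    by (rule hull_minimal[rotated])
  with i show False by auto
qed

text \<open>
  The standard simplex on \<^term>\<open>card A\<close> vertices, with its vertices mapped to the points of \<open>A\<close>.
\<close>

lemma polytope_as_image_of_simplex:
  fixes A :: "'a::real_vector set"
  assumes "finite A"
  obtains d P and T :: "(nat \<Rightarrow> real) \<Rightarrow> 'a"
  where "polytope P" "P \<subseteq> vec_space d" "finite {F. is_facet F P}" "card {F. is_facet F P} \<le> card A"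
    "linear T" "T ` vec_space d \<subseteq> span A" "T ` P = convex hull A"
proof -
  define d where "d = card A"
  obtain p where p: "bij_betw p {..<d} A"
    using ex_bij_betw_nat_finite[OF assms] unfolding d_def atLeast0LessThan by blast
  define P where "P = convex hull (std_basis d)"
  define T where "T = (\<lambda>y. \<Sum>i<d. y i *\<^sub>R p i)"
  have fin: "finite (std_basis d)" and card: "card (std_basis d) \<le> d"
    unfolding std_basis_def using card_image_le[of "{..<d}"] by auto
  note sub = facets_of_simplex[OF fin affine_independent_std_basis, folded P_def]
  have lin: "linear T"
    unfolding T_def by (intro linearI) (simp_all add: scaleR_add_left sum.distrib scaleR_sum_right)
  have vertex: "T (\<lambda>j. of_bool (i = j)) = p i" if "i < d" for i
  proof -
    have "T (\<lambda>j. of_bool (i = j)) = (\<Sum>j<d. if j = i then p j else 0)"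
      unfolding T_def by (intro sum.cong) auto
    then show ?thesis using that by simp
  qed
  have "convex (vec_space d)" by (simp add: convex_def vec_space_def)
  show ?thesis
  proof (rule that[of P d T])
    show "polytope P" using fin unfolding P_def polytope_def by blast
    show "P \<subseteq> vec_space d"
      unfolding P_def by (intro hull_minimal \<open>convex (vec_space d)\<close>) (auto simp: std_basis_def vec_space_def)
    show "finite {F. is_facet F P}" using sub fin by (rule finite_subset[OF _ finite_imageI])
    have "card {F. is_facet F P} \<le> card (std_basis d)"
      using surj_card_le[OF fin sub] .
    then show "card {F. is_facet F P} \<le> card A" using card d_def by simp
    show "linear T" by (rule lin)
    show "T ` vec_space d \<subseteq> span A"
      unfolding T_def using bij_betwE[OF p]
      by (clarify, intro span_sum span_scale span_base) auto
    have "T ` std_basis d = A"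
      unfolding std_basis_def image_image using p vertex by (simp add: bij_betw_def)
    then show "T ` P = convex hull A"
      unfolding P_def by (simp add: convex_hull_linear_image[OF lin])
  qed
qed

section \<open>Graphs and Hamiltonian cycles\<close>

definition edges_on :: "'a set \<Rightarrow> 'a set set"
  where "edges_on S = {e. e \<subseteq> S \<and> card e = 2}"

definition vertex_degree :: "'a set set \<Rightarrow> 'a \<Rightarrow> nat"
  where "vertex_degree E a = card {e \<in> E. a \<in> e}"

lemma complete_graph_eq_edges_on: "complete_graph n = edges_on {1..n}"
  unfolding complete_graph_def edges_on_def card_2_iff by (auto; blast)

lemma finite_edges_on: "finite S \<Longrightarrow> finite (edges_on S)"
  unfolding edges_on_def by simp

lemma sum_adjacent_eq_degree:
  assumes "finite S" "E \<subseteq> edges_on S"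
  shows "(\<Sum>b\<in>S. of_bool ({a, b} \<in> E)) = real (vertex_degree E a)"
proof -
  have ne: "a \<noteq> b" if "{a, b} \<in> E" for b
    using assms(2) that by (auto simp: edges_on_def)
  have "bij_betw (\<lambda>b. {a, b}) {b \<in> S. {a, b} \<in> E} {e \<in> E. a \<in> e}"
    unfolding bij_betw_def
  proof
    show "inj_on (\<lambda>b. {a, b}) {b \<in> S. {a, b} \<in> E}"
      by (auto simp: inj_on_def doubleton_eq_iff)
    show "(\<lambda>b. {a, b}) ` {b \<in> S. {a, b} \<in> E} = {e \<in> E. a \<in> e}"
    proof (intro subset_antisym subsetI)
      fix e assume "e \<in> {e \<in> E. a \<in> e}"
      then have e: "e \<in> E" "a \<in> e" "e \<subseteq> S" "card e = 2" using assms(2) by (auto simp: edges_on_def)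
      then obtain b where "e = {a, b}" by (auto simp: card_2_iff)
      then show "e \<in> (\<lambda>b. {a, b}) ` {b \<in> S. {a, b} \<in> E}" using e by auto
    qed auto
  qed
  then have "card {b \<in> S. {a, b} \<in> E} = vertex_degree E a"
    unfolding vertex_degree_def by (rule bij_betw_same_card)
  then show ?thesis
    using assms(1) by (simp add: Int_def)
qed

lemma sum_degree:
  assumes "finite S" "E \<subseteq> edges_on S"
  shows "(\<Sum>a\<in>S. vertex_degree E a) = 2 * card E"
proof -
  have fin: "finite E" using assms finite_edges_on finite_subset by blast
  have "(\<Sum>a\<in>S. vertex_degree E a) = (\<Sum>a\<in>S. \<Sum>e\<in>E. of_bool (a \<in> e))"
    unfolding vertex_degree_def using fin by (simp add: Int_def)
  also have "\<dots> = (\<Sum>e\<in>E. \<Sum>a\<in>S. of_bool (a \<in> e))" by (rule sum.swap)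
  also have "\<dots> = (\<Sum>e\<in>E. 2)"
  proof (rule sum.cong[OF refl])
    fix e assume "e \<in> E"
    then have "e \<subseteq> S" "card e = 2" using assms(2) by (auto simp: edges_on_def)
    then show "(\<Sum>a\<in>S. of_bool (a \<in> e)) = (2::nat)"
      using assms(1) by (simp add: Int_absorb1)
  qed
  finally show ?thesis by simp
qed

lemma degree_eq_0:
  assumes "E \<subseteq> edges_on S" "a \<notin> S"
  shows "vertex_degree E a = 0"
proof -
  have "{e \<in> E. a \<in> e} = {}" using assms by (auto simp: edges_on_def)
  then show ?thesis by (simp only: vertex_degree_def card.empty)
qed

lemma degree_edges_on:
  assumes "finite S" "a \<in> S"
  shows "vertex_degree (edges_on S) a = card S - 1"
proof -
  have "real (vertex_degree (edges_on S) a) = (\<Sum>b\<in>S. of_bool ({a, b} \<in> edges_on S))"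
    by (simp only: sum_adjacent_eq_degree[OF assms(1) subset_refl])
  also have "\<dots> = (\<Sum>b\<in>S. of_bool (b \<noteq> a))"
    using assms(2) by (intro sum.cong) (auto simp: edges_on_def card_2_iff doubleton_eq_iff)
  also have "\<dots> = real (card (S - {a}))"
    using assms(1) by (simp add: Int_def set_diff_eq)
  finally show ?thesis using assms by simp
qed

definition cycle_edge :: "'a list \<Rightarrow> nat \<Rightarrow> 'a set"
  where "cycle_edge vs p = {vs ! p, vs ! (Suc p mod length vs)}"

lemma cycle_edges_eq_image: "cycle_edges vs = cycle_edge vs ` {..<length vs}"
  unfolding cycle_edges_def cycle_edge_def by auto

lemma Suc_mod_neq:
  assumes "2 \<le> n" "p < n"
  shows "Suc p mod n \<noteq> (p::nat)"
  using assms by (cases "Suc p = n") auto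

lemma cycle_edge_in_edges_on:
  assumes "distinct vs" "2 \<le> length vs" "p < length vs"
  shows "cycle_edge vs p \<in> edges_on (set vs)"
proof -
  have q: "Suc p mod length vs < length vs" using assms by (intro mod_less_divisor) auto
  show ?thesis
    using assms q Suc_mod_neq[OF assms(2,3)]
    by (auto simp: cycle_edge_def edges_on_def card_2_iff nth_eq_iff_index_eq doubleton_eq_iff
        intro!: exI)
qed

lemma inj_on_cycle_edge:
  assumes "distinct vs" "3 \<le> length vs"
  shows "inj_on (cycle_edge vs) {..<length vs}"
proof (rule inj_onI)
  let ?n = "length vs"
  fix p q assume pq: "p \<in> {..<?n}" "q \<in> {..<?n}" and eq: "cycle_edge vs p = cycle_edge vs q"
  have lt: "Suc p mod ?n < ?n" "Suc q mod ?n < ?n" using pq by (intro mod_less_divisor; auto)+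
  have "p = q \<or> p = Suc q mod ?n \<and> Suc p mod ?n = q"
    using eq pq lt assms(1) by (auto simp: cycle_edge_def doubleton_eq_iff nth_eq_iff_index_eq)
  then show "p = q"
    using pq assms(2) by (cases "Suc p = ?n"; cases "Suc q = ?n") auto
qed

text \<open>
  Rotation invariance of sums around a cycle: it gives every vertex degree 2, and every edge the
  same frequency among the rotated matchings.
\<close>

lemma sum_mod_shift:
  fixes f :: "nat \<Rightarrow> 'a::comm_monoid_add"
  shows "(\<Sum>p<n. f ((p + t) mod n)) = (\<Sum>p<n. f p)"
proof (cases "n = 0")
  case False
  have "inj_on (\<lambda>p. (p + t) mod n) {..<n}"
  proof (rule inj_onI)
    fix p q assume pq: "p \<in> {..<n}" "q \<in> {..<n}" "(p + t) mod n = (q + t) mod n"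
    have "n dvd q - p" "n dvd p - q"
      using pq(3) by (cases "p \<le> q"; force simp: mod_eq_dvd_iff_nat dest: sym)+
    moreover have "q - p < n" "p - q < n" using pq by auto
    ultimately have "\<not> 0 < q - p" "\<not> 0 < p - q" using nat_dvd_not_less by blast+
    then show "p = q" by simp
  qed
  moreover have "(\<lambda>p. (p + t) mod n) ` {..<n} \<subseteq> {..<n}" using False by auto
  ultimately have "bij_betw (\<lambda>p. (p + t) mod n) {..<n} {..<n}"
    by (simp add: bij_betw_def endo_inj_surj)
  then show ?thesis by (rule sum.reindex_bij_betw)
qed simp

lemma card_cycle_edges:
  assumes "distinct vs" "3 \<le> length vs"
  shows "card (cycle_edges vs) = length vs"
  unfolding cycle_edges_eq_image by (simp add: card_image inj_on_cycle_edge[OF assms])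

lemma degree_cycle_edges:
  assumes "distinct vs" "3 \<le> length vs" "a \<in> set vs"
  shows "vertex_degree (cycle_edges vs) a = 2"
proof -
  let ?n = "length vs"
  have one: "(\<Sum>p<?n. of_bool (vs ! p = a)) = (1::nat)"
  proof -
    obtain i where i: "i < ?n" "vs ! i = a" using assms(3) by (auto simp: in_set_conv_nth)
    have "(\<Sum>p<?n. of_bool (vs ! p = a)) = (\<Sum>p<?n. if p = i then 1 else (0::nat))"
      using i assms(1) by (intro sum.cong) (auto simp: nth_eq_iff_index_eq)
    then show ?thesis using i by simp
  qed
  have "vertex_degree (cycle_edges vs) a = (\<Sum>e\<in>cycle_edges vs. of_bool (a \<in> e))"
    by (simp add: vertex_degree_def cycle_edges_eq_image Int_def)
  also have "\<dots> = (\<Sum>p<?n. of_bool (a \<in> cycle_edge vs p))"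
    unfolding cycle_edges_eq_image by (simp add: sum.reindex[OF inj_on_cycle_edge[OF assms(1,2)]])
  also have "\<dots> = (\<Sum>p<?n. of_bool (vs ! p = a) + of_bool (vs ! ((p + 1) mod ?n) = a))"
  proof (rule sum.cong[OF refl])
    fix p assume p: "p \<in> {..<?n}"
    then have "Suc p mod ?n < ?n" "Suc p mod ?n \<noteq> p"
      using assms(2) Suc_mod_neq[of ?n p] by (auto intro!: mod_less_divisor)
    then have "vs ! (Suc p mod ?n) \<noteq> vs ! p"
      using p assms(1) by (simp add: nth_eq_iff_index_eq)
    then show "of_bool (a \<in> cycle_edge vs p) =
        of_bool (vs ! p = a) + (of_bool (vs ! ((p + 1) mod ?n) = a) :: nat)"
      by (auto simp: cycle_edge_def)
  qed
  also have "\<dots> = 2"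
    by (simp only: sum.distrib sum_mod_shift[of "\<lambda>p. of_bool (vs ! p = a)"] one)
  finally show ?thesis .
qed

lemma cycle_edges_subset:
  assumes "distinct vs" "2 \<le> length vs"
  shows "cycle_edges vs \<subseteq> edges_on (set vs)"
  unfolding cycle_edges_eq_image using cycle_edge_in_edges_on[OF assms] by blast

section \<open>Edge deviations\<close>

text \<open>
  The average of all Hamiltonian cycles through \<open>e\<close>, minus the barycenter: by symmetry, a vertex
  on \<open>e\<close> is joined to each vertex off \<open>e\<close> with probability \<open>1/(n-2)\<close>, and two vertices off
  \<open>e\<close> are joined with probability \<open>2/(n-2)\<close>.
\<close>

definition edge_deviation :: "nat \<Rightarrow> nat set \<Rightarrow> nat \<Rightarrow> nat \<Rightarrow> real"
  where "edge_deviation n e = (\<lambda>i j. if i \<in> {1..n} \<and> j \<in> {1..n} \<and> i \<noteq> j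
    then of_bool ({i, j} = e) - (of_bool (i \<in> e) + of_bool (j \<in> e)) / (real n - 2)
      + 2 / ((real n - 1) * (real n - 2)) else 0)"

lemma sum_edge_deviation:
  assumes "finite E"
  shows "(\<Sum>e\<in>E. edge_deviation n e) = (\<lambda>i j. if i \<in> {1..n} \<and> j \<in> {1..n} \<and> i \<noteq> j
    then of_bool ({i, j} \<in> E) - (real (vertex_degree E i) + real (vertex_degree E j)) / (real n - 2)
      + 2 * real (card E) / ((real n - 1) * (real n - 2)) else 0)"
proof (intro ext)
  fix i j
  have deg: "(\<Sum>e\<in>E. of_bool (x \<in> e)) = real (vertex_degree E x)" for x
    using assms by (simp add: vertex_degree_def Int_def)
  have edge: "(\<Sum>e\<in>E. of_bool (x = e)) = (of_bool (x \<in> E) :: real)" for x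
    using assms by (auto simp: of_bool_def)
  have "(\<Sum>e\<in>E. of_bool ({i, j} = e) - (of_bool (i \<in> e) + of_bool (j \<in> e)) / (real n - 2)
      + 2 / ((real n - 1) * (real n - 2))) =
      of_bool ({i, j} \<in> E) - (real (vertex_degree E i) + real (vertex_degree E j)) / (real n - 2)
      + 2 * real (card E) / ((real n - 1) * (real n - 2))"
    by (simp add: sum.distrib sum_subtractf deg edge flip: sum_divide_distrib)
  then show "(\<Sum>e\<in>E. edge_deviation n e) i j = (if i \<in> {1..n} \<and> j \<in> {1..n} \<and> i \<noteq> j
    then of_bool ({i, j} \<in> E) - (real (vertex_degree E i) + real (vertex_degree E j)) / (real n - 2)
      + 2 * real (card E) / ((real n - 1) * (real n - 2)) else 0)"
    by (cases "i \<in> {1..n} \<and> j \<in> {1..n} \<and> i \<noteq> j")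
      (simp_all only: sum_fun_apply edge_deviation_def simp_thms if_True if_False sum.neutral_const)
qed

text \<open>
  Only the degrees and the number of edges enter the corrections to the incidence matrix, so they
  are the same for every Hamiltonian cycle and amount to the barycenter.
\<close>

lemma sum_edge_deviation_cycle:
  assumes "distinct vs" "set vs = {1..n}" "3 \<le> n"
  shows "(\<Sum>e\<in>cycle_edges vs. edge_deviation n e) =
    incidence_matrix (cycle_edges vs) - barycenter n"
proof (intro ext)
  fix i j
  let ?H = "cycle_edges vs"
  have len: "length vs = n" using assms distinct_card by fastforce
  have fin: "finite ?H" by (simp add: cycle_edges_eq_image)
  show "(\<Sum>e\<in>?H. edge_deviation n e) i j = (incidence_matrix ?H - barycenter n) i j"
  proof (cases "i \<in> {1..n} \<and> j \<in> {1..n} \<and> i \<noteq> j")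
    case True
    have "- (4 / (real n - 2)) + 2 * real n / ((real n - 1) * (real n - 2)) = - (2 / (real n - 1))"
      using assms(3) by (simp add: divide_simps)
    with True show ?thesis
      using assms len
      by (simp add: sum_edge_deviation[OF fin] degree_cycle_edges card_cycle_edges
          incidence_matrix_def barycenter_def)
  next
    case False
    have "{i, j} \<notin> ?H"
      using cycle_edges_subset[OF assms(1)] len assms(2,3) False
      by (auto simp: edges_on_def card_2_iff doubleton_eq_iff subset_iff)
    with False show ?thesis
      by (auto simp: sum_edge_deviation[OF fin] incidence_matrix_def barycenter_def)
  qed
qed

section \<open>Symmetric points of the traveling salesman polytope\<close>

lemma convex_tsp_polytope: "convex (tsp_polytope n)"
  unfolding tsp_polytope_def by (rule convex_convex_hull)

lemma incidence_matrix_in_tsp_polytope: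
  assumes "distinct vs" "set vs = {1..n}" "3 \<le> n"
  shows "incidence_matrix (cycle_edges vs) \<in> tsp_polytope n"
proof -
  have "length vs = n" using assms distinct_card by fastforce
  then have "cycle_edges vs \<in> hamiltonian_cycles {1..n} (complete_graph n)"
    using assms cycle_edges_subset[of vs]
    unfolding hamiltonian_cycles_def complete_graph_eq_edges_on by auto
  then show ?thesis unfolding tsp_polytope_def by (intro hull_inc) blast
qed

text \<open>
  Linear equations from which a sufficiently symmetric point of the polytope can be computed.
\<close>

lemma tsp_polytope_subset:
  "tsp_polytope n \<subseteq> {A \<in> matrix_space n. (\<forall>i j. A i j = A j i) \<and> (\<forall>i. A i i = 0) \<and>
    (\<forall>i\<in>{1..n}. (\<Sum>j\<in>{1..n}. A i j) = 2)}" (is "_ \<subseteq> ?C")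
  unfolding tsp_polytope_def
proof (rule hull_minimal)
  show "convex ?C"
    unfolding convex_def matrix_space_def
    by (simp add: sum.distrib flip: sum_distrib_left)
  show "incidence_matrix ` hamiltonian_cycles {1..n} (complete_graph n) \<subseteq> ?C"
  proof clarify
    fix H assume "H \<in> hamiltonian_cycles {1..n} (complete_graph n)"
    then obtain vs where vs: "H = cycle_edges vs" "distinct vs" "set vs = {1..n}" "3 \<le> length vs"
      and sub: "H \<subseteq> edges_on {1..n}"
      unfolding hamiltonian_cycles_def complete_graph_eq_edges_on by blast
    have "(\<Sum>j\<in>{1..n}. incidence_matrix H i j) = 2" if "i \<in> {1..n}" for i
      using sum_adjacent_eq_degree[OF _ sub, of i] degree_cycle_edges[OF vs(2,4), of i] vs(1,3) that
      by (simp add: incidence_matrix_def of_bool_def)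
    moreover have "{i, j} \<notin> H" if "i \<notin> {1..n} \<or> j \<notin> {1..n}" for i j
      using sub that by (auto simp: edges_on_def)
    moreover have "{i} \<notin> H" for i
      using sub by (auto simp: edges_on_def)
    ultimately show "incidence_matrix H \<in> matrix_space n \<and>
      (\<forall>i j. incidence_matrix H i j = incidence_matrix H j i) \<and>
      (\<forall>i. incidence_matrix H i i = 0) \<and>
      (\<forall>i\<in>{1..n}. (\<Sum>j\<in>{1..n}. incidence_matrix H i j) = 2)"
      by (auto simp: matrix_space_def incidence_matrix_def insert_commute)
  qed
qed

lemma cycle_edges_map: "cycle_edges (map f vs) = (\<lambda>e. f ` e) ` cycle_edges vs"
proof -
  have "cycle_edge (map f vs) p = f ` cycle_edge vs p" if "p < length vs" for p
  proof -
    have "Suc p mod length vs < length vs" using that by (intro mod_less_divisor) auto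
    then show ?thesis using that by (simp add: cycle_edge_def)
  qed
  then show ?thesis
    unfolding cycle_edges_eq_image image_image length_map by (intro image_cong) auto
qed

text \<open>
  The witness is the average of the cycle over all permutations that move only vertices of \<open>U\<close>.
\<close>

lemma tsp_symmetrization:
  assumes "distinct vs" "set vs = {1..n}" "3 \<le> n" "U \<subseteq> {1..n}"
  obtains R where "R \<in> tsp_polytope n"
    "\<And>a b. a \<notin> U \<Longrightarrow> b \<notin> U \<Longrightarrow> R a b = incidence_matrix (cycle_edges vs) a b"
    "\<And>\<sigma> a b. \<sigma> permutes U \<Longrightarrow> R (\<sigma> a) (\<sigma> b) = R a b"
proof -
  let ?G = "{\<sigma>. \<sigma> permutes U}"
  let ?X = "incidence_matrix (cycle_edges vs)"
  define R where "R = (\<Sum>\<sigma>\<in>?G. (1 / real (card ?G)) *\<^sub>R (\<lambda>a b. ?X (\<sigma> a) (\<sigma> b)))"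
  have finU: "finite U" using assms(4) finite_subset by blast
  have finG: "finite ?G" using finU by (rule finite_permutations)
  have cardG: "card ?G > 0" using finG permutes_id[of U] unfolding card_gt_0_iff by blast
  have vertex: "(\<lambda>a b. ?X (\<sigma> a) (\<sigma> b)) \<in> tsp_polytope n" if "\<sigma> permutes U" for \<sigma>
  proof -
    have \<sigma>: "\<sigma> permutes {1..n}" using that assms(4) by (rule permutes_subset)
    have \<tau>: "inv \<sigma> permutes {1..n}" using \<sigma> by (rule permutes_inv)
    have "(\<lambda>e. inv \<sigma> ` e) ` cycle_edges vs = {e. \<sigma> ` e \<in> cycle_edges vs}"
    proof (intro subset_antisym subsetI)
      fix e assume "e \<in> {e. \<sigma> ` e \<in> cycle_edges vs}"
      moreover have "e = inv \<sigma> ` \<sigma> ` e" using permutes_inj[OF \<sigma>] by (simp add: image_inv_f_f)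
      ultimately show "e \<in> (\<lambda>e. inv \<sigma> ` e) ` cycle_edges vs" by blast
    qed (use permutes_surj[OF \<sigma>] in \<open>auto simp: image_f_inv_f\<close>)
    then have "(\<lambda>a b. ?X (\<sigma> a) (\<sigma> b)) = incidence_matrix (cycle_edges (map (inv \<sigma>) vs))"
      by (simp add: incidence_matrix_def cycle_edges_map fun_eq_iff)
    also have "\<dots> \<in> tsp_polytope n"
      using assms(1-3) permutes_inj[OF \<tau>] permutes_image[OF \<tau>]
      by (intro incidence_matrix_in_tsp_polytope) (auto simp: distinct_map intro: inj_on_subset)
    finally show ?thesis .
  qed
  have R_apply: "R a b = (\<Sum>\<sigma>\<in>?G. ?X (\<sigma> a) (\<sigma> b)) / real (card ?G)" for a b
    by (simp add: R_def sum_fun_apply sum_divide_distrib)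
  show thesis
  proof (rule that[of R])
    show "R \<in> tsp_polytope n"
      unfolding R_def using finG cardG vertex
      by (intro convex_sum convex_tsp_polytope) (auto intro!: exI[of _ id] permutes_id)
  next
    fix a b assume "a \<notin> U" "b \<notin> U"
    then have "(\<Sum>\<sigma>\<in>?G. ?X (\<sigma> a) (\<sigma> b)) = (\<Sum>\<sigma>\<in>?G. ?X a b)"
      by (intro sum.cong) (auto simp: permutes_not_in)
    then show "R a b = ?X a b" using cardG by (simp add: R_apply)
  next
    fix \<sigma> a b assume "\<sigma> permutes U"
    then show "R (\<sigma> a) (\<sigma> b) = R a b"
      using sum_permutations_compose_right[of \<sigma> U "\<lambda>\<rho>. ?X (\<rho> a) (\<rho> b)"]
      by (simp add: R_apply)
  qed
qed

text \<open>
  Permutations act doubly transitively, so a symmetrized matrix is constant on the off-diagonal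
  entries inside \<open>U\<close>.
\<close>

lemma exists_permutation_of_pair:
  assumes "u \<in> U" "v \<in> U" "u' \<in> U" "v' \<in> U" "u \<noteq> v" "u' \<noteq> v'"
  obtains \<sigma> where "\<sigma> permutes U" "\<sigma> u = u'" "\<sigma> v = v'"
proof -
  define w where "w = Transposition.transpose u u' v"
  have w: "w \<in> U" "w \<noteq> u'"
    using assms by (auto simp: w_def Transposition.transpose_def)
  show thesis
  proof (rule that)
    show "Transposition.transpose w v' \<circ> Transposition.transpose u u' permutes U"
      using assms w by (intro permutes_compose permutes_swap_id) auto
  qed (use assms w in \<open>auto simp flip: w_def\<close>)
qed

section \<open>Matchings realised inside the polytope\<close>

lemma card_edges_on: "finite S \<Longrightarrow> card (edges_on S) = card S choose 2"
  unfolding edges_on_def by (rule n_subsets)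

text \<open>
  In a random cycle that contains a given matching of \<open>k\<close> edges and joins no two of their
  endpoints otherwise, let \<open>p\<close> be the probability that a given endpoint is joined to a given free
  vertex, and \<open>q\<close> the probability that two given free vertices are joined. This is \<open>2p - q\<close>,
  which measures how far the entries are from being sums of a row term and a column term.
\<close>

definition overlap :: "nat \<Rightarrow> nat \<Rightarrow> real"
  where "overlap n k = (2 * real k - 2) / ((real n - 2 * real k) * (real n - 2 * real k - 1))"

text \<open>
  The entries of the symmetrized cycle, compared with the barycenter and the edge deviations. For a
  pair of endpoints these contribute nothing beyond the indicator of the matching, so their other
  terms cancel. An endpoint is joined to a free vertex with probability \<open>1/(n-2k)\<close>, and the last
  identity concerns two free vertices.
\<close>

lemma completion_entries:
  fixes n k :: real
  assumes "1 \<le> k" "2 * k + 2 \<le> n"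
  defines "\<mu> \<equiv> (2 * k - 2) / ((n - 2 * k) * (n - 2 * k - 1))"
  shows
    "2 / (n - 1) - 2 / (n - 2) + 2 * k / ((n - 1) * (n - 2))
      = \<mu> * (1 - 2 * (2 * k - 1) / (n - 2) + 2 * (k * (2 * k - 1)) / ((n - 1) * (n - 2)))"
    "1 / (n - 2 * k) = 2 / (n - 1) - 1 / (n - 2) + 2 * k / ((n - 1) * (n - 2))
      - \<mu> * (2 * (k * (2 * k - 1)) / ((n - 1) * (n - 2)) - (2 * k - 1) / (n - 2))"
    "(2 - 2 * k / (n - 2 * k)) / (n - 2 * k - 1) = 2 / (n - 1) + 2 * k / ((n - 1) * (n - 2))
      - \<mu> * (2 * (k * (2 * k - 1)) / ((n - 1) * (n - 2)))"
proof -
  define N where "N = n - 2 * k"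
  have n: "n = N + 2 * k" and nz: "N \<noteq> 0" "N - 1 \<noteq> 0" "N + 2 * k - 1 \<noteq> 0" "N + 2 * k - 2 \<noteq> 0"
    using assms(1,2) by (auto simp: N_def)
  show "2 / (n - 1) - 2 / (n - 2) + 2 * k / ((n - 1) * (n - 2))
      = \<mu> * (1 - 2 * (2 * k - 1) / (n - 2) + 2 * (k * (2 * k - 1)) / ((n - 1) * (n - 2)))"
    unfolding \<mu>_def n using nz by (simp add: divide_simps) (simp add: algebra_simps)
  show "1 / (n - 2 * k) = 2 / (n - 1) - 1 / (n - 2) + 2 * k / ((n - 1) * (n - 2))
      - \<mu> * (2 * (k * (2 * k - 1)) / ((n - 1) * (n - 2)) - (2 * k - 1) / (n - 2))"
    unfolding \<mu>_def n using nz by (simp add: divide_simps) (simp add: algebra_simps)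
  show "(2 - 2 * k / (n - 2 * k)) / (n - 2 * k - 1) = 2 / (n - 1) + 2 * k / ((n - 1) * (n - 2))
      - \<mu> * (2 * (k * (2 * k - 1)) / ((n - 1) * (n - 2)))"
    unfolding \<mu>_def n using nz by (simp add: divide_simps) (simp add: algebra_simps)
qed

text \<open>
  This point is the average of the cycle over the permutations of the vertices outside \<open>S\<close>. Since
  \<open>M\<close> uses up one of the two edges at each vertex of \<open>S\<close>, the other edge leaves \<open>S\<close> and is spread
  evenly over the free vertices; the row sums of the free vertices then determine the rest. The
  subtracted term records that the averaged cycles avoid all pairs in \<open>S\<close> other than those of \<open>M\<close>.
\<close>

lemma average_completion_of_matching:
  fixes vs :: "nat list" and S :: "nat set"
  defines "M \<equiv> {e \<in> cycle_edges vs. e \<subseteq> S}"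
  assumes vs: "distinct vs" "set vs = {1..n}" and S: "S \<subseteq> {1..n}"
    and matching: "\<And>a. a \<in> S \<Longrightarrow> vertex_degree M a = 1"
    and k: "card M = k" "1 \<le> k" "2 * k + 2 \<le> n"
  shows "barycenter n + (\<Sum>e\<in>M. edge_deviation n e)
    - overlap n k *\<^sub>R (\<Sum>e\<in>edges_on S. edge_deviation n e) \<in> tsp_polytope n"
proof -
  let ?X = "incidence_matrix (cycle_edges vs)"
  define U where "U = {1..n} - S"
  have n3: "3 \<le> n" using k by linarith
  have len: "length vs = n" using vs distinct_card by fastforce
  have finS: "finite S" and finU: "finite U" using S finite_subset unfolding U_def by blast+
  have M: "M \<subseteq> edges_on S"
    using cycle_edges_subset[OF vs(1)] len n3 unfolding M_def edges_on_def by auto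
  have finM: "finite M" using M finite_edges_on[OF finS] finite_subset by blast
  have "(\<Sum>a\<in>S. vertex_degree M a) = card S" using matching by simp
  then have cardS: "card S = 2 * k" using sum_degree[OF finS M] k(1) by simp
  have cardU: "real (card U) = real n - 2 * real k"
    using k S finS cardS by (simp add: U_def card_Diff_subset of_nat_diff)
  have degM: "real (vertex_degree M a) = of_bool (a \<in> S)" for a
    using matching degree_eq_0[OF M] by auto
  have degS: "real (vertex_degree (edges_on S) a) = (2 * real k - 1) * of_bool (a \<in> S)" for a
    using degree_edges_on[OF finS] degree_eq_0[OF subset_refl] k(2)
    by (auto simp: cardS of_nat_diff)
  have cardE: "real (card (edges_on S)) = real k * (2 * real k - 1)"
    using k(2) by (simp add: card_edges_on[OF finS] cardS choose_two of_nat_diff)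
  obtain R where R: "R \<in> tsp_polytope n"
    and fixed: "\<And>a b. a \<notin> U \<Longrightarrow> b \<notin> U \<Longrightarrow> R a b = ?X a b"
    and inv: "\<And>\<sigma> a b. \<sigma> permutes U \<Longrightarrow> R (\<sigma> a) (\<sigma> b) = R a b"
    using tsp_symmetrization[OF vs n3, of U] unfolding U_def by blast
  have Rprops: "R \<in> matrix_space n" "\<And>a b. R a b = R b a" "\<And>a. R a a = 0"
    "\<And>a. a \<in> {1..n} \<Longrightarrow> (\<Sum>b\<in>{1..n}. R a b) = 2"
    using subsetD[OF tsp_polytope_subset R] by auto
  have split: "(\<Sum>b\<in>{1..n}. R a b) = (\<Sum>b\<in>S. R a b) + (\<Sum>b\<in>U. R a b)" for a
    unfolding U_def using sum.subset_diff[OF S, of "R a"] by simp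
  have inS: "R a b = of_bool ({a, b} \<in> M)" if "a \<in> S" "b \<in> S" for a b
    using fixed[of a b] that unfolding M_def U_def incidence_matrix_def by auto
  \<comment> \<open>row sum of an endpoint: 1 within \<open>S\<close>, the remaining 1 spread over \<open>U\<close>\<close>
  have cross: "R a u = 1 / (real n - 2 * real k)" if a: "a \<in> S" and u: "u \<in> U" for a u
  proof -
    have "R a v = R a u" if v: "v \<in> U" for v
    proof -
      have "a \<noteq> u" "a \<noteq> v" using a u v by (auto simp: U_def)
      then show ?thesis
        using inv[OF permutes_swap_id[OF u v], of a u] by (simp add: transpose_apply_other)
    qed
    then have "(\<Sum>v\<in>U. R a v) = (real n - 2 * real k) * R a u"
      by (simp add: cardU)
    moreover have "(\<Sum>b\<in>S. R a b) = 1"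
      using inS a sum_adjacent_eq_degree[OF finS M, of a] matching by simp
    moreover have "a \<in> {1..n}" using a S by blast
    ultimately have "1 + (real n - 2 * real k) * R a u = 2"
      using split[of a] Rprops(4)[of a] by simp
    then show ?thesis using k by (simp add: field_simps)
  qed
  \<comment> \<open>row sum of a free vertex, with the entries towards \<open>S\<close> already known\<close>
  have outside: "R u v = (2 - 2 * real k / (real n - 2 * real k)) / (real n - 2 * real k - 1)"
    if u: "u \<in> U" and v: "v \<in> U" and "u \<noteq> v" for u v
  proof -
    have "R u w = R u v" if "w \<in> U - {u}" for w
    proof -
      obtain \<sigma> where "\<sigma> permutes U" "\<sigma> u = u" "\<sigma> v = w"
        using exists_permutation_of_pair[of u U v u w] u v \<open>u \<noteq> v\<close> \<open>w \<in> U - {u}\<close> by blast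
      then show ?thesis using inv[of \<sigma> u v] by simp
    qed
    then have "(\<Sum>w\<in>U - {u}. R u w) = real (card (U - {u})) * R u v" by simp
    moreover have "real (card (U - {u})) = real n - 2 * real k - 1"
      using cardU u finU k(3) by (simp add: of_nat_diff)
    moreover have "(\<Sum>w\<in>U. R u w) = (\<Sum>w\<in>U - {u}. R u w)"
      using finU u Rprops(3) by (simp add: sum.remove)
    moreover have "(\<Sum>b\<in>S. R u b) = 2 * real k / (real n - 2 * real k)"
      using cross u by (simp add: Rprops(2)[of u] cardS)
    moreover have "u \<in> {1..n}" using u U_def by blast
    ultimately have "2 * real k / (real n - 2 * real k) + (real n - 2 * real k - 1) * R u v = 2"
      using split[of u] Rprops(4)[of u] by simp
    then show ?thesis using k by (simp add: eq_divide_eq algebra_simps)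
  qed
  have "barycenter n + (\<Sum>e\<in>M. edge_deviation n e)
    - overlap n k *\<^sub>R (\<Sum>e\<in>edges_on S. edge_deviation n e) = R" (is "?Y = R")
  proof (intro ext)
    fix a b
    have k23: "1 \<le> real k" "2 * real k + 2 \<le> real n" using k by linarith+
    note entries = completion_entries[of "real k" "real n", folded overlap_def, OF k23]
    show "?Y a b = R a b"
    proof (cases "a \<in> {1..n} \<and> b \<in> {1..n} \<and> a \<noteq> b")
      case False
      then have "R a b = 0" using Rprops(1,3) unfolding matrix_space_def by auto
      moreover have "?Y a b = 0"
        using False by (auto simp: barycenter_def sum_fun_apply edge_deviation_def)
      ultimately show ?thesis by simp
    next
      case True
      then have "{a, b} \<in> edges_on S \<longleftrightarrow> a \<in> S \<and> b \<in> S" by (auto simp: edges_on_def)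
      moreover have "{a, b} \<in> M \<Longrightarrow> a \<in> S \<and> b \<in> S" using M by (auto simp: edges_on_def)
      ultimately have Y: "?Y a b = 2 / (real n - 1)
        + (of_bool ({a, b} \<in> M) - (of_bool (a \<in> S) + of_bool (b \<in> S)) / (real n - 2)
            + 2 * real k / ((real n - 1) * (real n - 2)))
        - overlap n k * (of_bool (a \<in> S \<and> b \<in> S)
            - ((2 * real k - 1) * of_bool (a \<in> S) + (2 * real k - 1) * of_bool (b \<in> S)) / (real n - 2)
            + 2 * (real k * (2 * real k - 1)) / ((real n - 1) * (real n - 2)))"
        using True
        by (simp add: sum_edge_deviation[OF finM] sum_edge_deviation[OF finite_edges_on[OF finS]]
            degM degS cardE k(1) barycenter_def)
      have M_sub: "{a, b} \<in> M \<Longrightarrow> a \<in> S \<and> b \<in> S" using M by (auto simp: edges_on_def)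
      consider "a \<in> S" "b \<in> S" | "a \<in> S" "b \<in> U" | "a \<in> U" "b \<in> S" | "a \<in> U" "b \<in> U"
        using True U_def by blast
      then show ?thesis
      proof cases
        case 1
        then have "?Y a b = of_bool ({a, b} \<in> M)
          + (2 / (real n - 1) - 2 / (real n - 2) + 2 * real k / ((real n - 1) * (real n - 2))
          - overlap n k * (1 - 2 * (2 * real k - 1) / (real n - 2)
            + 2 * (real k * (2 * real k - 1)) / ((real n - 1) * (real n - 2))))"
          unfolding Y by (simp flip: mult_2)
        then show ?thesis unfolding entries(1) inS[OF 1] by simp
      next
        case 2
        then have "b \<notin> S" "{a, b} \<notin> M" using M_sub by (auto simp: U_def)
        then show ?thesis unfolding Y cross[OF 2] entries(2) using 2(1) by simp
      next
        case 3
        then have "a \<notin> S" "{a, b} \<notin> M" using M_sub by (auto simp: U_def)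
        then show ?thesis unfolding Y Rprops(2)[of a b] cross[OF 3(2,1)] entries(2) using 3(2) by simp
      next
        case 4
        then have "a \<notin> S" "b \<notin> S" "{a, b} \<notin> M" using M_sub by (auto simp: U_def)
        moreover have "a \<noteq> b" using True by simp
        ultimately show ?thesis unfolding Y outside[OF 4 \<open>a \<noteq> b\<close>] entries(3) by simp
      qed
    qed
  qed
  then show ?thesis using R by simp
qed

lemma weighted_average_in_convex:
  fixes x :: "'a::real_vector"
  assumes "convex C" "x \<in> C" "finite I" "\<And>i. i \<in> I \<Longrightarrow> f i \<in> C" "0 \<le> \<mu>"
  shows "(1 / (1 + \<mu> * real (card I))) *\<^sub>R (x + \<mu> *\<^sub>R (\<Sum>i\<in>I. f i)) \<in> C"
proof (cases "I = {}")
  case False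
  then have card: "0 < real (card I)" using assms(3) by (simp add: card_gt_0_iff)
  have mean: "(\<Sum>i\<in>I. (1 / real (card I)) *\<^sub>R f i) \<in> C"
    using assms card by (intro convex_sum) auto
  let ?w = "1 + \<mu> * real (card I)"
  have w: "0 < ?w" using assms(5) card by (simp add: add_pos_nonneg)
  have "(1 / ?w) *\<^sub>R x + (\<mu> * real (card I) / ?w) *\<^sub>R (\<Sum>i\<in>I. (1 / real (card I)) *\<^sub>R f i) \<in> C"
    using assms(5) w card by (intro convexD[OF assms(1,2) mean]) (auto simp flip: add_divide_distrib)
  also have "(\<mu> * real (card I) / ?w) *\<^sub>R (\<Sum>i\<in>I. (1 / real (card I)) *\<^sub>R f i)
      = (1 / ?w) *\<^sub>R \<mu> *\<^sub>R (\<Sum>i\<in>I. f i)"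
    using card by (simp flip: scaleR_sum_right)
  finally show ?thesis by (simp add: scaleR_add_right)
qed (use assms(2) in simp)

text \<open>
  The case of a single edge, where \<open>S\<close> contains no pair besides the edge itself and the overlap
  vanishes.
\<close>

lemma edge_point_in_tsp_polytope:
  assumes "4 \<le> n" "e \<in> edges_on {1..n}"
  shows "barycenter n + edge_deviation n e \<in> tsp_polytope n"
proof -
  obtain a b where e: "e = {a, b}" "a \<noteq> b" "a \<in> {1..n}" "b \<in> {1..n}"
    using assms(2) by (auto simp: edges_on_def card_2_iff)
  define vs where "vs = a # b # sorted_list_of_set ({1..n} - {a, b})"
  have vs: "distinct vs" "set vs = {1..n}" using e by (auto simp: vs_def)
  have len: "length vs = n" using vs distinct_card by fastforce
  have "cycle_edge vs 0 = e"
    using assms(1) len by (simp add: cycle_edge_def) (simp add: vs_def e)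
  then have "e \<in> cycle_edges vs"
    unfolding cycle_edges_eq_image using len assms(1) by force
  moreover have "f = e" if "f \<in> cycle_edges vs" "f \<subseteq> e" for f
    using cycle_edges_subset[OF vs(1)] len assms that e(1,2) card_subset_eq[of e f]
    by (auto simp: edges_on_def)
  ultimately have M: "{f \<in> cycle_edges vs. f \<subseteq> e} = {e}" by blast
  have deg: "vertex_degree {e} x = 1" if "x \<in> e" for x
  proof -
    have "{f \<in> {e}. x \<in> f} = {e}" using that by blast
    then show ?thesis by (simp add: vertex_degree_def)
  qed
  have "overlap n 1 = 0" by (simp add: overlap_def)
  moreover have "e \<subseteq> {1..n}" using e by simp
  ultimately show ?thesis
    using average_completion_of_matching[OF vs, of e 1] assms(1) deg by (simp add: M)
qed

text \<open>
  In the mixture of the average completion with the points of the avoided pairs, each matching edge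
  has coefficient \<open>1 - \<mu>\<close>; the \<open>2k(k-1)\<close> avoided pairs bring the total weight to the denominator.
\<close>

definition damping :: "nat \<Rightarrow> nat \<Rightarrow> real"
  where "damping n k = (1 - overlap n k) / (1 + overlap n k * (2 * real k * (real k - 1)))"

text \<open>
  The average completion lacks \<open>\<mu> D(e)\<close> for every pair \<open>e\<close> in \<open>S\<close>. For the pairs outside \<open>M\<close> this
  is compensated by mixing in the points \<open>Z + D(e)\<close> with weight \<open>\<mu>\<close>.
\<close>

lemma matching_point_in_tsp_polytope:
  fixes vs :: "nat list" and S :: "nat set"
  defines "M \<equiv> {e \<in> cycle_edges vs. e \<subseteq> S}"
  assumes vs: "distinct vs" "set vs = {1..n}" and S: "S \<subseteq> {1..n}"
    and matching: "\<And>a. a \<in> S \<Longrightarrow> vertex_degree M a = 1"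
    and k: "card M = k" "1 \<le> k" "2 * k + 2 \<le> n"
  shows "barycenter n + damping n k *\<^sub>R (\<Sum>e\<in>M. edge_deviation n e) \<in> tsp_polytope n"
proof -
  define I where "I = edges_on S - M"
  define \<mu> where "\<mu> = overlap n k"
  define Z where "Z = barycenter n"
  define D where "D = edge_deviation n"
  have n3: "4 \<le> n" using k by linarith
  have len: "length vs = n" using vs distinct_card by fastforce
  have finS: "finite S" using S finite_subset by blast
  have M: "M \<subseteq> edges_on S"
    using cycle_edges_subset[OF vs(1)] len n3 unfolding M_def edges_on_def by auto
  have finE: "finite (edges_on S)" using finite_edges_on[OF finS] .
  have finM: "finite M" using M finE finite_subset by blast
  have "(\<Sum>a\<in>S. vertex_degree M a) = card S" using matching by simp
  then have cardS: "card S = 2 * k" using sum_degree[OF finS M] k(1) by simp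
  have "real (card (edges_on S)) = real k * (2 * real k - 1)"
    using k(2) by (simp add: card_edges_on[OF finS] cardS choose_two of_nat_diff)
  moreover have "card (edges_on S) = card I + k"
    using card_Diff_subset[OF finM M] card_mono[OF finE M] k(1) by (simp add: I_def)
  ultimately have cardI: "real (card I) = 2 * real k * (real k - 1)"
    by (simp add: algebra_simps)
  have \<mu>: "0 \<le> \<mu>" using k unfolding \<mu>_def overlap_def by auto
  define w where "w = 1 + \<mu> * real (card I)"
  have w: "0 < w" unfolding w_def using \<mu> by (simp add: add_pos_nonneg)
  have "(1 / w) *\<^sub>R ((Z + (\<Sum>e\<in>M. D e) - \<mu> *\<^sub>R (\<Sum>e\<in>edges_on S. D e))
      + \<mu> *\<^sub>R (\<Sum>e\<in>I. Z + D e)) \<in> tsp_polytope n"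
    unfolding w_def
  proof (rule weighted_average_in_convex[OF convex_tsp_polytope])
    show "Z + (\<Sum>e\<in>M. D e) - \<mu> *\<^sub>R (\<Sum>e\<in>edges_on S. D e) \<in> tsp_polytope n"
      using average_completion_of_matching[OF vs S matching[unfolded M_def] k(1)[unfolded M_def] k(2,3)]
      by (simp add: M_def Z_def D_def \<mu>_def)
    show "finite I" using finE by (simp add: I_def)
    show "Z + D e \<in> tsp_polytope n" if "e \<in> I" for e
      using edge_point_in_tsp_polytope[OF n3, of e] that S
      by (auto simp: I_def edges_on_def Z_def D_def)
  qed (rule \<mu>)
  also have "(\<Sum>e\<in>I. Z + D e) = real (card I) *\<^sub>R Z + ((\<Sum>e\<in>edges_on S. D e) - (\<Sum>e\<in>M. D e))"
    unfolding I_def by (simp only: sum_diff[OF finE M, of D] sum.distrib sum_constant_scaleR)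
  also have "(1 / w) *\<^sub>R ((Z + (\<Sum>e\<in>M. D e) - \<mu> *\<^sub>R (\<Sum>e\<in>edges_on S. D e))
      + \<mu> *\<^sub>R (real (card I) *\<^sub>R Z + ((\<Sum>e\<in>edges_on S. D e) - (\<Sum>e\<in>M. D e))))
      = (1 / w) *\<^sub>R (w *\<^sub>R Z + (1 - \<mu>) *\<^sub>R (\<Sum>e\<in>M. D e))"
    by (simp add: w_def algebra_simps)
  also have "\<dots> = Z + ((1 - \<mu>) / w) *\<^sub>R (\<Sum>e\<in>M. D e)"
    using w by (simp add: scaleR_add_right)
  finally show ?thesis
    by (simp only: damping_def w_def cardI Z_def D_def \<mu>_def)
qed

text \<open>
  Taking every third edge leaves a free vertex between consecutive matching edges, so the cycle has
  no other edge between endpoints.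
\<close>

lemma spaced_matching_point_in_tsp_polytope:
  assumes vs: "distinct vs" "set vs = {1..n}" and k: "1 \<le> k" "2 * k + 2 \<le> n" "3 * k \<le> n"
  shows "barycenter n + damping n k *\<^sub>R (\<Sum>i<k. edge_deviation n {vs ! (3 * i), vs ! (3 * i + 1)})
    \<in> tsp_polytope n"
proof -
  have len: "length vs = n" using vs distinct_card by fastforce
  have n4: "4 \<le> n" using k by linarith
  define S where "S = {vs ! p |p. p < 3 * k \<and> p mod 3 \<noteq> 2}"
  define M where "M = {e \<in> cycle_edges vs. e \<subseteq> S}"
  have in_S: "vs ! p \<in> S \<longleftrightarrow> p < 3 * k \<and> p mod 3 \<noteq> 2" if "p < n" for p
    using that len k(3) vs(1) by (auto simp: S_def nth_eq_iff_index_eq)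
  have edge: "cycle_edge vs (3 * i) = {vs ! (3 * i), vs ! (3 * i + 1)}" if "i < k" for i
    using that k(3) by (simp add: cycle_edge_def len)
  have M_eq: "M = (\<lambda>i. cycle_edge vs (3 * i)) ` {..<k}"
  proof (intro subset_antisym subsetI)
    fix e assume "e \<in> M"
    then obtain p where p: "p < n" "e = cycle_edge vs p" "e \<subseteq> S"
      by (auto simp: M_def cycle_edges_eq_image len)
    define q where "q = Suc p mod n"
    have "q < n" using p by (simp add: q_def)
    have pq: "p < 3 * k" "p mod 3 \<noteq> 2" "q < 3 * k" "q mod 3 \<noteq> 2"
      using p(2,3) in_S[OF p(1)] in_S[OF \<open>q < n\<close>] by (auto simp: cycle_edge_def len q_def)
    have "p mod 3 = 0"
    proof (rule ccontr)
      assume "p mod 3 \<noteq> 0"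
      then have p1: "p mod 3 = 1" using pq(2) by linarith
      then have "Suc p mod 3 = 2" by presburger
      moreover have "Suc p < n" using p1 pq(1) k(3) by presburger
      ultimately show False using pq(4) by (simp add: q_def)
    qed
    then have "p = 3 * (p div 3)" "p div 3 < k" using pq(1) by auto
    then show "e \<in> (\<lambda>i. cycle_edge vs (3 * i)) ` {..<k}" using p(2) by (metis imageI lessThan_iff)
  next
    fix e assume "e \<in> (\<lambda>i. cycle_edge vs (3 * i)) ` {..<k}"
    then obtain i where i: "i < k" "e = cycle_edge vs (3 * i)" by blast
    then have "3 * i < n" "3 * i + 1 < n" "3 * i + 1 < 3 * k" "(3 * i + 1) mod 3 \<noteq> 2"
      using k(3) by (linarith, linarith, linarith, presburger)
    then have "e \<subseteq> S" using i in_S[of "3 * i"] in_S[of "3 * i + 1"] edge by simp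
    moreover have "e \<in> cycle_edges vs"
      using i \<open>3 * i < n\<close> by (auto simp: cycle_edges_eq_image len)
    ultimately show "e \<in> M" by (simp add: M_def)
  qed
  have inj: "inj_on (\<lambda>i. cycle_edge vs (3 * i)) {..<k}"
  proof (rule inj_onI)
    fix i j assume ij: "i \<in> {..<k}" "j \<in> {..<k}" "cycle_edge vs (3 * i) = cycle_edge vs (3 * j)"
    then show "i = j"
      using inj_onD[OF inj_on_cycle_edge[OF vs(1)], of "3 * i" "3 * j"] len k(3) n4 by simp
  qed
  have degree: "vertex_degree M a = 1" if a: "a \<in> S" for a
  proof -
    obtain p where p: "a = vs ! p" "p < 3 * k" "p mod 3 \<noteq> 2" using a unfolding S_def by blast
    have "a \<in> cycle_edge vs (3 * i) \<longleftrightarrow> i = p div 3" if "i < k" for i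
    proof -
      have "a \<in> cycle_edge vs (3 * i) \<longleftrightarrow> p = 3 * i \<or> p = 3 * i + 1"
        using p that k(3) vs(1) by (auto simp: edge nth_eq_iff_index_eq len)
      also have "\<dots> \<longleftrightarrow> i = p div 3" using p(3) by presburger
      finally show ?thesis .
    qed
    moreover have "p div 3 < k" using p(2) by auto
    ultimately have "{e \<in> M. a \<in> e} = {cycle_edge vs (3 * (p div 3))}"
      unfolding M_eq by auto
    then show ?thesis by (simp add: vertex_degree_def)
  qed
  have "S \<subseteq> {1..n}" unfolding S_def vs(2)[symmetric] using k(3) len by auto
  moreover have "card M = k" unfolding M_eq by (simp add: card_image inj)
  ultimately have "barycenter n + damping n k *\<^sub>R (\<Sum>e\<in>M. edge_deviation n e) \<in> tsp_polytope n"
    using matching_point_in_tsp_polytope[OF vs, of S k] degree k(1,2) unfolding M_def by simp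
  also have "(\<Sum>e\<in>M. edge_deviation n e) = (\<Sum>i<k. edge_deviation n (cycle_edge vs (3 * i)))"
    unfolding M_eq by (simp add: sum.reindex[OF inj])
  also have "\<dots> = (\<Sum>i<k. edge_deviation n {vs ! (3 * i), vs ! (3 * i + 1)})"
    by (intro sum.cong) (simp_all add: edge)
  finally show ?thesis .
qed

section \<open>Few points spanning a contracted copy\<close>

text \<open>
  The candidate points are indexed by all lists of \<open>2k\<close> vertices, read as \<open>k\<close> consecutive pairs;
  this makes counting them immediate. Intersecting with the polytope discards the lists that do not
  describe a suitable matching.
\<close>

definition edge_list_points :: "nat \<Rightarrow> nat \<Rightarrow> (nat \<Rightarrow> nat \<Rightarrow> real) set"
  where "edge_list_points n k =
    (\<lambda>t. barycenter n + damping n k *\<^sub>R (\<Sum>i<k. edge_deviation n {t ! (2 * i), t ! (2 * i + 1)}))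
      ` {t. set t \<subseteq> {1..n} \<and> length t = 2 * k} \<inter> tsp_polytope n"

lemma finite_edge_list_points: "finite (edge_list_points n k)"
  unfolding edge_list_points_def by (simp add: finite_lists_length_eq)

lemma card_edge_list_points: "card (edge_list_points n k) \<le> n ^ (2 * k)"
proof -
  let ?L = "{t. set t \<subseteq> {1..n} \<and> length t = 2 * k}"
  have "card (edge_list_points n k) \<le> card ?L"
    unfolding edge_list_points_def
    by (intro order.trans[OF card_mono[OF _ Int_lower1] card_image_le] finite_imageI)
      (simp_all add: finite_lists_length_eq)
  then show ?thesis by (simp add: card_lists_length_eq)
qed

text \<open>
  Among the \<open>n\<close> rotations of the spaced matching around the cycle, each edge of the cycle occurs
  exactly \<open>k\<close> times. So the mean of the corresponding points is a multiple of the sum of the edge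
  deviations over the whole cycle.
\<close>

lemma contracted_vertex_in_hull:
  assumes vs: "distinct vs" "set vs = {1..n}" and k: "1 \<le> k" "2 * k + 2 \<le> n" "3 * k \<le> n"
  shows "barycenter n + (damping n k * real k / real n) *\<^sub>R
    (incidence_matrix (cycle_edges vs) - barycenter n) \<in> convex hull (edge_list_points n k)"
proof -
  have len: "length vs = n" using vs distinct_card by fastforce
  have n3: "3 \<le> n" using k by linarith
  let ?D = "edge_deviation n" and ?\<alpha> = "damping n k"
  define D where "D = (\<lambda>p. ?D (cycle_edge vs p))"
  define Y where "Y = (\<lambda>j. barycenter n + ?\<alpha> *\<^sub>R (\<Sum>i<k. D ((3 * i + j) mod n)))"
  have Y_in: "Y j \<in> edge_list_points n k" for j
  proof -
    define ws where "ws = rotate j vs"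
    \<comment> \<open>drops every third vertex: positions \<open>2i\<close> and \<open>2i+1\<close> of \<open>t\<close> hold positions \<open>3i\<close> and \<open>3i+1\<close> of \<open>ws\<close>\<close>
    define t where "t = map (\<lambda>m. ws ! (3 * (m div 2) + m mod 2)) [0..<2 * k]"
    have ws: "distinct ws" "set ws = {1..n}" "length ws = n"
      using vs len by (simp_all add: ws_def)
    have edge: "cycle_edge vs ((3 * i + j) mod n) = {ws ! (3 * i), ws ! (3 * i + 1)}" if "i < k" for i
    proof -
      have "3 * i < n" "3 * i + 1 < n" using that k(3) by linarith+
      then show ?thesis
        by (simp add: cycle_edge_def ws_def nth_rotate len mod_Suc_eq add.commute)
    qed
    have t: "t ! (2 * i) = ws ! (3 * i)" "t ! (2 * i + 1) = ws ! (3 * i + 1)" if "i < k" for i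
      using that by (simp_all add: t_def)
    have "set t \<subseteq> {1..n}"
    proof -
      have "3 * (m div 2) + m mod 2 < n" if "m < 2 * k" for m
      proof -
        have "m div 2 < k" "m mod 2 < 2" using that by auto
        then show ?thesis using k(3) by linarith
      qed
      then show ?thesis using ws(3) unfolding ws(2)[symmetric] by (auto simp: t_def)
    qed
    moreover have "length t = 2 * k" by (simp add: t_def)
    moreover have Y: "Y j = barycenter n + ?\<alpha> *\<^sub>R (\<Sum>i<k. ?D {ws ! (3 * i), ws ! (3 * i + 1)})"
      unfolding Y_def D_def using edge by simp
    moreover have "Y j \<in> tsp_polytope n"
      unfolding Y by (rule spaced_matching_point_in_tsp_polytope[OF ws(1,2) k])
    moreover have "Y j = barycenter n + ?\<alpha> *\<^sub>R (\<Sum>i<k. ?D {t ! (2 * i), t ! (2 * i + 1)})"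
      unfolding Y using t by simp
    ultimately show ?thesis unfolding edge_list_points_def by blast
  qed
  have "(\<Sum>j<n. \<Sum>i<k. D ((3 * i + j) mod n)) = (\<Sum>i<k. \<Sum>j<n. D ((j + 3 * i) mod n))"
    by (subst sum.swap) (simp add: add.commute)
  also have "\<dots> = real k *\<^sub>R (\<Sum>p<n. D p)"
    by (simp only: sum_mod_shift sum_constant_scaleR card_lessThan)
  also have "(\<Sum>p<n. D p) = (\<Sum>e\<in>cycle_edges vs. ?D e)"
    using inj_on_cycle_edge[OF vs(1)] len n3
    by (simp add: cycle_edges_eq_image D_def sum.reindex)
  also have "\<dots> = incidence_matrix (cycle_edges vs) - barycenter n"
    by (rule sum_edge_deviation_cycle[OF vs n3])
  finally have total: "(\<Sum>j<n. \<Sum>i<k. D ((3 * i + j) mod n)) =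
    real k *\<^sub>R (incidence_matrix (cycle_edges vs) - barycenter n)" .
  have "(\<Sum>j<n. (1 / real n) *\<^sub>R Y j) \<in> convex hull (edge_list_points n k)"
    using n3 Y_in by (intro convex_sum convex_convex_hull hull_inc) auto
  also have "(\<Sum>j<n. (1 / real n) *\<^sub>R Y j) =
    barycenter n + (?\<alpha> / real n) *\<^sub>R (\<Sum>j<n. \<Sum>i<k. D ((3 * i + j) mod n))"
    using n3 by (simp add: Y_def scaleR_add_right sum.distrib sum_constant_scaleR scaleR_sum_right del: sum_constant)
  finally show ?thesis by (simp only: total scaleR_scaleR times_divide_eq_left)
qed

text \<open>
  With \<open>N = n - 2k \<ge> n/2\<close> the overlap \<open>\<mu>\<close> satisfies \<open>\<mu>n \<le> 4\<close>, and \<open>1 - \<alpha>\<close> is at most about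
  \<open>2k\<^sup>2\<mu>\<close>. Hence \<open>(1 - \<alpha>)k \<le> 2k\<^sup>3\<mu> \<le> 2n\<mu> \<le> 8\<close>; this is where \<open>k\<^sup>3 \<le> n\<close> enters.
\<close>

lemma damping_bounds:
  assumes "1 \<le> k" "4 * k \<le> n" "k ^ 3 \<le> n"
  shows "0 < damping n k" "\<bar>damping n k * real k / real n - real k / real n\<bar> \<le> 8 / real n"
proof -
  define K x \<mu> where "K = real k" and "x = real n" and "\<mu> = overlap n k"
  have K: "1 \<le> K" "4 * K \<le> x" "K ^ 3 \<le> x"
    using assms unfolding K_def x_def by (simp_all flip: of_nat_power)
  define N where "N = x - 2 * K"
  have N: "x / 2 \<le> N" "x / 4 \<le> N - 1" "2 * K \<le> N" "1 \<le> N - 1" using K by (auto simp: N_def)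
  have \<mu>_eq: "\<mu> = (2 * K - 2) / (N * (N - 1))"
    by (simp add: \<mu>_def overlap_def N_def K_def x_def)
  have \<mu>0: "0 \<le> \<mu>" using K N by (simp add: \<mu>_eq)
  have \<mu>1: "\<mu> < 1"
  proof -
    have "2 * K - 2 < N * 1" using N by simp
    also have "\<dots> \<le> N * (N - 1)" using N by (intro mult_left_mono) auto
    finally show ?thesis using N by (simp add: \<mu>_eq)
  qed
  have \<mu>x: "\<mu> * x \<le> 4"
  proof -
    have "(x / 2) * (x / 4) \<le> N * (N - 1)" using N K by (intro mult_mono) auto
    then have "x * x \<le> 8 * (N * (N - 1))" by simp
    moreover have "(2 * K - 2) * x \<le> (x / 2) * x" using K by (intro mult_right_mono) auto
    ultimately have "(2 * K - 2) * x \<le> 4 * (N * (N - 1))" by simp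
    moreover have "0 < N * (N - 1)" using N K by simp
    ultimately show ?thesis by (simp add: \<mu>_eq divide_le_eq)
  qed
  define m where "m = 2 * K * (K - 1)"
  have m: "0 \<le> m" using K by (simp add: m_def)
  have \<alpha>: "damping n k = (1 - \<mu>) / (1 + \<mu> * m)"
    by (simp add: damping_def \<mu>_def m_def K_def)
  have pos: "0 < 1 + \<mu> * m" using \<mu>0 m by (simp add: add_pos_nonneg)
  show "0 < damping n k" using \<mu>1 pos by (simp add: \<alpha>)
  have "1 - damping n k = \<mu> * (1 + m) / (1 + \<mu> * m)"
    using pos by (simp add: \<alpha> field_simps)
  also have "\<dots> \<le> \<mu> * (1 + m)"
    using \<mu>0 m pos mult_left_mono[of 1 "1 + \<mu> * m" "\<mu> * (1 + m)"] by (simp add: divide_le_eq)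
  finally have "(1 - damping n k) * K \<le> \<mu> * (1 + m) * K" using K by (intro mult_right_mono) auto
  also have "\<dots> = \<mu> * ((1 + m) * K)" by simp
  also have "\<dots> \<le> \<mu> * (2 * K ^ 3)"
  proof (rule mult_left_mono[OF _ \<mu>0])
    have "(1 + m) * K \<le> (2 * K * K) * K"
      using K by (intro mult_right_mono) (auto simp: m_def algebra_simps)
    then show "(1 + m) * K \<le> 2 * K ^ 3" by (simp add: power3_eq_cube mult.assoc)
  qed
  also have "\<dots> \<le> \<mu> * (2 * x)" using K(3) \<mu>0 by (intro mult_left_mono) auto
  also have "\<dots> \<le> 8" using \<mu>x by simp
  finally have upper: "(1 - damping n k) * K \<le> 8" .
  have "0 \<le> 1 - damping n k"
    unfolding \<open>1 - damping n k = \<mu> * (1 + m) / (1 + \<mu> * m)\<close> using \<mu>0 m pos by simp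
  then have "\<bar>damping n k * K - K\<bar> \<le> 8"
    using upper K by (simp add: abs_if algebra_simps)
  then have "\<bar>damping n k * K - K\<bar> / x \<le> 8 / x" using K by (intro divide_right_mono) auto
  then show "\<bar>damping n k * real k / real n - real k / real n\<bar> \<le> 8 / real n"
    using K by (simp add: K_def x_def flip: diff_divide_distrib)
qed

text \<open>
  The points whose contraction lies in the hull form a convex set, so the vertices suffice.
\<close>

lemma contraction_in_hull:
  assumes k: "1 \<le> k" "2 * k + 2 \<le> n" "3 * k \<le> n" and x: "x \<in> tsp_polytope n"
  shows "barycenter n + (damping n k * real k / real n) *\<^sub>R (x - barycenter n)
    \<in> convex hull (edge_list_points n k)"
proof -
  define c where "c = damping n k * real k / real n"
  define Z where "Z = barycenter n"
  define C where "C = {x. Z + c *\<^sub>R (x - Z) \<in> convex hull (edge_list_points n k)}"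
  have "convex C"
  proof (rule convexI)
    fix x y and u v :: real
    assume xy: "x \<in> C" "y \<in> C" and uv: "0 \<le> u" "0 \<le> v" "u + v = 1"
    have v: "v = 1 - u" using uv(3) by simp
    have "Z + c *\<^sub>R (u *\<^sub>R x + v *\<^sub>R y - Z) = u *\<^sub>R (Z + c *\<^sub>R (x - Z)) + v *\<^sub>R (Z + c *\<^sub>R (y - Z))"
      unfolding v by (simp add: algebra_simps)
    then show "u *\<^sub>R x + v *\<^sub>R y \<in> C"
      using xy uv unfolding C_def mem_Collect_eq by (simp only: convexD[OF convex_convex_hull])
  qed
  moreover have "incidence_matrix ` hamiltonian_cycles {1..n} (complete_graph n) \<subseteq> C"
    using contracted_vertex_in_hull[OF _ _ k]
    unfolding hamiltonian_cycles_def C_def c_def Z_def by auto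
  ultimately have "tsp_polytope n \<subseteq> C"
    unfolding tsp_polytope_def by (intro hull_minimal)
  then show ?thesis using x by (auto simp: C_def c_def Z_def)
qed

section \<open>The approximating polytope\<close>

lemma barycenter_in_matrix_space: "barycenter n \<in> matrix_space n"
  by (auto simp: barycenter_def matrix_space_def)

lemma subspace_matrix_space: "subspace (matrix_space n)"
  by (auto simp: subspace_def matrix_space_def)

theorem theorem1p2:
  shows "\<exists>C1 C2 :: real. 0 < C1 \<and> 0 < C2 \<and>
    (\<forall>n k :: nat. 4 \<le> n \<longrightarrow> 1 \<le> k \<longrightarrow> real k \<le> real n powr (1 / 3) \<longrightarrow>
      (\<exists>(d :: nat) (P :: (nat \<Rightarrow> real) set)
         (T :: (nat \<Rightarrow> real) \<Rightarrow> (nat \<Rightarrow> nat \<Rightarrow> real)) (c :: real).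
        polytope P \<and> P \<subseteq> vec_space d \<and>
        finite {F. is_facet F P} \<and>
        real (card {F. is_facet F P}) \<le> C1 * real n ^ (4 * k) \<and>
        linear T \<and> T ` vec_space d \<subseteq> matrix_space n \<and>
        \<bar>c - real k / real n\<bar> \<le> C2 / real n \<and>
        (let Q = T ` P; Z = barycenter n in
          set_scale c (set_minus_vec Q Z) \<subseteq> set_minus_vec (tsp_polytope n) Z \<and>
          set_minus_vec (tsp_polytope n) Z \<subseteq> set_minus_vec Q Z)))"
proof (rule exI[of _ 1], rule exI[of _ 8], intro conjI allI impI)
  fix n k :: nat
  assume n: "4 \<le> n" and k: "1 \<le> k" and "real k \<le> real n powr (1 / 3)"
  then have "real k ^ 3 \<le> (real n powr (1 / 3)) ^ 3" by (intro power_mono) auto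
  also have "\<dots> = real n" using n by (simp add: powr_power)
  finally have cube: "k ^ 3 \<le> n" by (simp flip: of_nat_power)
  have k4: "4 * k \<le> n"
  proof (cases "k = 1")
    case False
    then have "2 * 2 \<le> k * k" using k by (intro mult_mono) auto
    then have "4 * k \<le> k ^ 3" by (simp add: power3_eq_cube)
    then show ?thesis using cube by simp
  qed (use n in simp)
  have k23: "2 * k + 2 \<le> n" "3 * k \<le> n" using k k4 n by linarith+
  define A where "A = edge_list_points n k"
  define Z where "Z = barycenter n"
  define c where "c = damping n k * real k / real n"
  have c: "0 < c" "\<bar>c - real k / real n\<bar> \<le> 8 / real n"
    using damping_bounds[OF k k4 cube] n k by (simp_all add: c_def)
  define expand where "expand = (\<lambda>y. Z + (1 / c) *\<^sub>R (y - Z))"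
  have A_sub: "A \<subseteq> tsp_polytope n" by (auto simp: A_def edge_list_points_def)
  have hull_expand: "convex hull (expand ` A) = expand ` (convex hull A)"
  proof -
    have eq: "expand ` X = (+) (Z - (1 / c) *\<^sub>R Z) ` (\<lambda>x. (1 / c) *\<^sub>R x) ` X" for X
      by (simp only: image_image expand_def) (intro image_cong refl, simp add: algebra_simps)
    show ?thesis unfolding eq by (simp only: convex_hull_translation convex_hull_scaling)
  qed
  obtain d P and T :: "(nat \<Rightarrow> real) \<Rightarrow> nat \<Rightarrow> nat \<Rightarrow> real"
    where P: "polytope P" "P \<subseteq> vec_space d" "finite {F. is_facet F P}"
      "card {F. is_facet F P} \<le> card (expand ` A)"
    and T: "linear T" "T ` vec_space d \<subseteq> span (expand ` A)" "T ` P = convex hull (expand ` A)"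
    by (rule polytope_as_image_of_simplex[of "expand ` A"])
      (simp add: A_def finite_edge_list_points)
  have "card (expand ` A) \<le> card A"
    unfolding A_def by (rule card_image_le[OF finite_edge_list_points])
  also have "\<dots> \<le> n ^ (2 * k)" unfolding A_def by (rule card_edge_list_points)
  also have "\<dots> \<le> n ^ (4 * k)" using n by (intro power_increasing) auto
  finally have "card {F. is_facet F P} \<le> n ^ (4 * k)" using P(4) by simp
  then have facets: "real (card {F. is_facet F P}) \<le> 1 * real n ^ (4 * k)"
    by (simp flip: of_nat_power)
  have "expand ` A \<subseteq> matrix_space n"
  proof clarify
    fix y assume "y \<in> A"
    then have "y \<in> matrix_space n" using A_sub tsp_polytope_subset by blast
    then show "expand y \<in> matrix_space n"
      unfolding expand_def Z_def using subspace_matrix_space barycenter_in_matrix_space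
      by (intro subspace_add subspace_scale subspace_diff)
  qed
  then have range: "T ` vec_space d \<subseteq> matrix_space n"
    by (intro order.trans[OF T(2)] span_minimal subspace_matrix_space)
  have Q: "T ` P = expand ` (convex hull A)" by (simp only: T(3) hull_expand)
  have lower: "set_scale c (set_minus_vec (T ` P) Z) \<subseteq> set_minus_vec (tsp_polytope n) Z"
  proof -
    have "convex hull A \<subseteq> tsp_polytope n"
      using A_sub convex_tsp_polytope by (rule hull_minimal)
    moreover have "c *\<^sub>R (expand y - Z) = y - Z" for y using c(1) by (simp add: expand_def)
    ultimately show ?thesis
      unfolding Q set_scale_def set_minus_vec_def by (clarsimp) blast
  qed
  have upper: "set_minus_vec (tsp_polytope n) Z \<subseteq> set_minus_vec (T ` P) Z"
  proof -
    have "x \<in> expand ` (convex hull A)" if x: "x \<in> tsp_polytope n" for x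
    proof (rule image_eqI)
      show "Z + c *\<^sub>R (x - Z) \<in> convex hull A"
        using contraction_in_hull[OF k k23 x] unfolding A_def Z_def c_def .
      show "x = expand (Z + c *\<^sub>R (x - Z))" using c(1) by (simp add: expand_def)
    qed
    then show ?thesis unfolding Q set_minus_vec_def by blast
  qed
  show "\<exists>(d :: nat) (P :: (nat \<Rightarrow> real) set)
         (T :: (nat \<Rightarrow> real) \<Rightarrow> (nat \<Rightarrow> nat \<Rightarrow> real)) (c :: real).
        polytope P \<and> P \<subseteq> vec_space d \<and>
        finite {F. is_facet F P} \<and>
        real (card {F. is_facet F P}) \<le> 1 * real n ^ (4 * k) \<and>
        linear T \<and> T ` vec_space d \<subseteq> matrix_space n \<and>
        \<bar>c - real k / real n\<bar> \<le> 8 / real n \<and>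
        (let Q = T ` P; Z = barycenter n in
          set_scale c (set_minus_vec Q Z) \<subseteq> set_minus_vec (tsp_polytope n) Z \<and>
          set_minus_vec (tsp_polytope n) Z \<subseteq> set_minus_vec Q Z)"
    unfolding Let_def Z_def[symmetric]
    by (intro exI[of _ d] exI[of _ P] exI[of _ T] exI[of _ c] conjI P(1-3) facets T(1) range c(2)
        lower upper)
qed simp_all

end
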